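(* Let $M\ge 0$ be an integer and let $\vec\omega=\langle\omega_0,\dots,\omega_M\rangle$ be a vector of $M+1$ distinct complex numbers with $\omega_i-\omega_j\notin\mathbb Z$ for all $i\neq j$. Fix $\vec\rho\in\mathbb N^{M+1}$ (nonnegative integer coordinates) and $\vec\epsilon_0,\vec\epsilon_1,\dots,\vec\epsilon_M\in\mathbb Z^{M+1}$ such that each $\vec\rho+\vec\epsilon_k$ has nonnegative coordinates, and denote the $j$-th coordinate of $\vec\epsilon_i$ by $\epsilon_{i,j}$. Let $S$ be the maximum of $\sum_{i=0}^M\epsilon_{i,\beta(i)}$ taken over all permutations $\beta$ of $0,1,\dots,M$, and let $T$ be the minimum of $\sum_{j=0}^M\epsilon_{i,j}$ taken over $0\le i\le M$. Suppose the following two conditions are satisfied: (i) there is a unique permutation $\alpha$ of $0,1,\dots,M$ with $S=\sum_{i=0}^M\epsilon_{i,\alpha(i)}$; (ii) $T+M=S$. Then the $(M+1)\times(M+1)$ matrix whose $(k,m)$ coordinate is the polynomial $\mathrm{Poly}_m(z\mid\vec\omega;\vec\rho+\vec\epsilon_k)$ has determinant $$C\,z^{\sigma(\vec\rho)+T-1},$$ where $C$ does not depend on $z$.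
   Context: Vectors and matrices are indexed by $0,\dots,M$. For a vector $\vec\rho=\langle\rho_0,\dots,\rho_M\rangle$ of nonnegative integers, $\sigma(\vec\rho)=\sum_{m=0}^M(\rho_m+1)$. For complex $\omega$, $(1-z)^\omega$ denotes the principal branch near $z=0$ (equal to $1$ at $z=0$). Padé approximants: for $\vec\omega$ as in the statement and a vector $\vec\rho$ of $M+1$ nonnegative integers, there are unique polynomials $H_0,\dots,H_M$ with $\deg H_m\le\rho_m$ such that $G(z)=\sum_{m=0}^M H_m(z)(1-z)^{\omega_m}$ has a zero of order $\sigma(\vec\rho)-1$ at $z=0$ and $\lim_{z\to0}G(z)/z^{\sigma(\vec\rho)-1}=1/(\sigma(\vec\rho)-1)!$ (in fact $\deg H_m=\rho_m$). One writes $\mathrm{Poly}_m(z\mid\vec\omega;\vec\rho):=H_m(z)$. *)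

theory Defs
  imports "HOL-Complex_Analysis.Complex_Analysis" "Jordan_Normal_Form.Determinant"
begin

text \<open>A vector indexed by $0,\dots,M$ is a function on the natural numbers of which only the
  values at arguments up to $M$ matter.\<close>

definition pade_sigma :: "nat \<Rightarrow> (nat \<Rightarrow> nat) \<Rightarrow> nat" where
  "pade_sigma M \<rho> = (\<Sum>m\<le>M. \<rho> m + 1)"

text \<open>\<^const>\<open>powr\<close> on the complex numbers is the principal branch, so \<open>(1 - z) powr w\<close> is
  holomorphic near \<open>z = 0\<close> with value 1 there.\<close>

definition pade_fun ::
    "nat \<Rightarrow> (nat \<Rightarrow> complex) \<Rightarrow> (nat \<Rightarrow> complex poly) \<Rightarrow> complex \<Rightarrow> complex" where
  "pade_fun M \<omega> H z = (\<Sum>m\<le>M. poly (H m) z * (1 - z) powr \<omega> m)"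

definition is_pade_system ::
    "nat \<Rightarrow> (nat \<Rightarrow> complex) \<Rightarrow> (nat \<Rightarrow> nat) \<Rightarrow> (nat \<Rightarrow> complex poly) \<Rightarrow> bool" where
  "is_pade_system M \<omega> \<rho> H \<longleftrightarrow>
     (\<forall>m\<le>M. degree (H m) \<le> \<rho> m) \<and>
     zorder (pade_fun M \<omega> H) 0 = int (pade_sigma M \<rho> - 1) \<and>
     ((\<lambda>z. pade_fun M \<omega> H z / z ^ (pade_sigma M \<rho> - 1)) \<longlongrightarrow> 1 / fact (pade_sigma M \<rho> - 1)) (at 0)"

text \<open>Setting the components beyond \<open>M\<close> to zero only serves to make the family, as a function on
  all natural numbers, unique.\<close>

definition pade_poly ::
    "nat \<Rightarrow> (nat \<Rightarrow> complex) \<Rightarrow> (nat \<Rightarrow> nat) \<Rightarrow> nat \<Rightarrow> complex poly" where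
  "pade_poly M \<omega> \<rho> = (THE H. is_pade_system M \<omega> \<rho> H \<and> (\<forall>m>M. H m = 0))"

text \<open>The rest of this theory proves that the description above is proper. Uniqueness: the series
  $\sum_m K_m(z)(1-z)^{\omega_m}$ with $\deg K_m\le\rho_m$ vanishes to order \<open>pade_sigma M \<rho>\<close> only if
  all $K_m$ are zero, by induction on the number of terms: divide by one of the powers and
  differentiate its polynomial away. Existence then follows by counting the unknown
  coefficients.\<close>

lemma homogeneous_system_nontrivial:
  fixes a :: "nat \<Rightarrow> 'i \<Rightarrow> 'a :: field"
  assumes "finite I" "n < card I"
  shows "\<exists>x. (\<exists>i\<in>I. x i \<noteq> 0) \<and> (\<forall>k<n. (\<Sum>i\<in>I. a k i * x i) = 0)"
  using assms
proof (induction n arbitrary: I a)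
  case 0
  then have "I \<noteq> {}" by auto
  then show ?case by (intro exI[of _ "\<lambda>_. 1"]) auto
next
  case (Suc n)
  show ?case
  proof (cases "\<forall>i\<in>I. a n i = 0")
    case True
    from Suc.prems have "n < card I" by simp
    from Suc.IH[OF Suc.prems(1) this, of a] obtain x where
      "\<exists>i\<in>I. x i \<noteq> 0" "\<forall>k<n. (\<Sum>i\<in>I. a k i * x i) = 0" by blast
    with True show ?thesis by (intro exI[of _ x]) (auto simp: less_Suc_eq)
  next
    case False
    then obtain p where p: "p \<in> I" "a n p \<noteq> 0" by blast
    define J where "J = I - {p}"
    have J: "finite J" "n < card J" "p \<notin> J" "I = insert p J"
      using Suc.prems p by (auto simp: J_def)
    from Suc.IH[OF J(1,2), of "\<lambda>k i. a k i - a k p * a n i / a n p"] obtain x where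
      x: "\<exists>i\<in>J. x i \<noteq> 0"
         "\<And>k. k < n \<Longrightarrow> (\<Sum>i\<in>J. (a k i - a k p * a n i / a n p) * x i) = 0" by blast
    define s where "s = (\<Sum>i\<in>J. a n i * x i)"
    define y where "y = x(p := - s / a n p)"
    have sum_y: "(\<Sum>i\<in>I. a k i * y i) = a k p * (- s / a n p) + (\<Sum>i\<in>J. a k i * x i)" for k
    proof -
      have "(\<Sum>i\<in>J. a k i * y i) = (\<Sum>i\<in>J. a k i * x i)"
        using J(3) by (intro sum.cong) (auto simp: y_def)
      then show ?thesis using J by (simp add: y_def)
    qed
    have "(\<Sum>i\<in>I. a k i * y i) = 0" if "k < n" for k
    proof -
      have "(\<Sum>i\<in>J. (a k i - a k p * a n i / a n p) * x i)
          = (\<Sum>i\<in>J. a k i * x i) - (\<Sum>i\<in>J. (a k p / a n p) * (a n i * x i))"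
        unfolding sum_subtractf[symmetric] by (intro sum.cong) (auto simp: algebra_simps)
      also have "(\<Sum>i\<in>J. (a k p / a n p) * (a n i * x i)) = (a k p / a n p) * s"
        by (simp add: s_def sum_distrib_left)
      finally show ?thesis using x(2)[OF that] by (simp add: sum_y)
    qed
    moreover have "(\<Sum>i\<in>I. a n i * y i) = 0"
      using p(2) by (simp add: sum_y s_def)
    moreover have "\<exists>i\<in>I. y i \<noteq> 0" using x(1) J by (auto simp: y_def)
    ultimately show ?thesis by (intro exI[of _ y]) (auto simp: less_Suc_eq)
  qed
qed

definition powr_fps :: "complex \<Rightarrow> complex fps" where
  "powr_fps w = fps_compose (fps_binomial w) (- fps_X)"

lemma has_fps_expansion_powr_fps: "(\<lambda>z. (1 - z) powr w) has_fps_expansion powr_fps w"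
proof -
  have "((\<lambda>z. (1 + z) powr w) \<circ> (\<lambda>z. - z)) has_fps_expansion powr_fps w"
    unfolding powr_fps_def
    by (intro has_fps_expansion_compose has_fps_expansion_binomial_complex
          has_fps_expansion_minus has_fps_expansion_fps_X) simp
  then show ?thesis by (simp add: o_def)
qed

lemma powr_fps_add: "powr_fps (v + w) = powr_fps v * powr_fps w"
  unfolding powr_fps_def fps_binomial_add_mult by (rule fps_compose_mult_distrib) simp

lemma powr_fps_0 [simp]: "powr_fps 0 = 1"
  by (simp add: powr_fps_def)

lemma powr_fps_nth_0 [simp]: "fps_nth (powr_fps w) 0 = 1"
  by (simp add: powr_fps_def fps_compose_uminus')

lemma powr_fps_1: "powr_fps 1 = 1 - fps_X"
  by (simp add: powr_fps_def fps_binomial_1 fps_compose_add_distrib fps_X_fps_compose_startby0)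

lemma powr_fps_deriv: "fps_deriv (powr_fps w) = - fps_const w * powr_fps (w - 1)"
proof -
  have nz: "1 + fps_X \<noteq> (0 :: complex fps)"
    by (metis fps_nonzero_nth_minimal fps_zero_nth add.right_neutral fps_add_nth fps_one_nth
          fps_X_nth zero_neq_one)
  have "fps_binomial w = fps_binomial (w - 1) * (1 + fps_X)"
    using fps_binomial_add_mult[of "w - 1" 1] by (simp add: fps_binomial_1)
  then have "fps_deriv (fps_binomial w) = fps_const w * fps_binomial (w - 1)"
    unfolding fps_binomial_deriv using nz by (metis mult.assoc nonzero_mult_div_cancel_right)
  then show ?thesis
    by (simp add: powr_fps_def fps_compose_deriv fps_compose_mult_distrib
        flip: fps_const_neg)
qed

lemma deriv_poly_powr_fps:
  assumes "w \<notin> \<int>"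
  shows "\<exists>Q. degree Q \<le> degree P \<and> (Q = 0 \<longrightarrow> P = 0) \<and>
    fps_deriv (fps_of_poly P * powr_fps w) = fps_of_poly Q * powr_fps (w - 1)"
proof -
  define Q where "Q = [:1, - 1:] * pderiv P - Polynomial.smult w P"
  have coeff_Q: "coeff Q n = of_nat (n + 1) * coeff P (n + 1) - (of_nat n + w) * coeff P n" for n
    by (cases n) (auto simp: Q_def coeff_pderiv algebra_simps)
  have "degree Q \<le> degree P"
    by (rule degree_le) (auto simp: coeff_Q coeff_eq_0)
  moreover have "P = 0" if "Q = 0"
  proof (rule ccontr)
    assume "P \<noteq> 0"
    have "coeff Q (degree P) = - (of_nat (degree P) + w) * lead_coeff P"
      by (simp add: coeff_Q coeff_eq_0 algebra_simps)
    moreover have "of_nat (degree P) + w \<noteq> 0"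
    proof
      assume "of_nat (degree P) + w = 0"
      then have "w = of_int (- int (degree P))" by (simp add: eq_neg_iff_add_eq_0 add.commute)
      then show False using assms by (metis Ints_of_int)
    qed
    ultimately show False using that \<open>P \<noteq> 0\<close>
      by (metis coeff_0 leading_coeff_0_iff mult_eq_0_iff neg_equal_0_iff_equal)
  qed
  moreover have "fps_deriv (fps_of_poly P * powr_fps w) = fps_of_poly Q * powr_fps (w - 1)"
  proof -
    have *: "powr_fps w = (1 - fps_X) * powr_fps (w - 1)"
      using powr_fps_add[of 1 "w - 1"] by (simp add: powr_fps_1)
    have "fps_deriv (fps_of_poly P * powr_fps w) =
        fps_of_poly (pderiv P) * powr_fps w - fps_const w * fps_of_poly P * powr_fps (w - 1)"
      by (simp add: powr_fps_deriv fps_of_poly_pderiv algebra_simps flip: fps_const_neg)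
    also have "\<dots> = ((1 - fps_X) * fps_of_poly (pderiv P) - fps_const w * fps_of_poly P)
        * powr_fps (w - 1)"
      by (subst *) (simp add: algebra_simps)
    also have "(1 - fps_X) * fps_of_poly (pderiv P) - fps_const w * fps_of_poly P = fps_of_poly Q"
    proof (rule fps_ext)
      show "fps_nth ((1 - fps_X) * fps_of_poly (pderiv P) - fps_const w * fps_of_poly P) n =
          fps_nth (fps_of_poly Q) n" for n
        by (cases n) (simp_all add: coeff_Q coeff_pderiv algebra_simps)
    qed
    finally show ?thesis .
  qed
  ultimately show ?thesis by blast
qed

lemma deriv_poly_powr_fps_iterated:
  assumes "w \<notin> \<int>"
  shows "\<exists>Q. degree Q \<le> degree P \<and> (Q = 0 \<longrightarrow> P = 0) \<and>
    (fps_deriv ^^ n) (fps_of_poly P * powr_fps w) = fps_of_poly Q * powr_fps (w - of_nat n)"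
proof (induction n)
  case 0
  show ?case by (intro exI[of _ P]) simp
next
  case (Suc n)
  then obtain Q where Q: "degree Q \<le> degree P" "Q = 0 \<longrightarrow> P = 0"
    "(fps_deriv ^^ n) (fps_of_poly P * powr_fps w) = fps_of_poly Q * powr_fps (w - of_nat n)"
    by blast
  have "w - of_nat n \<notin> \<int>" using assms
    by (metis Ints_add Ints_of_nat diff_add_cancel)
  from deriv_poly_powr_fps[OF this, of Q] obtain R where R: "degree R \<le> degree Q"
    "R = 0 \<longrightarrow> Q = 0"
    "fps_deriv (fps_of_poly Q * powr_fps (w - of_nat n)) =
      fps_of_poly R * powr_fps (w - of_nat n - 1)" by blast
  have *: "w - of_nat (Suc n) = w - of_nat n - 1" by simp
  then show ?case using Q(1,2) R(1,2)
    unfolding funpow.simps o_apply Q(3) R(3) * by (intro exI[of _ R]) auto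
qed

lemma funpow_fps_deriv_sum:
  "(fps_deriv ^^ n) (\<Sum>i\<in>A. f i :: complex fps) = (\<Sum>i\<in>A. (fps_deriv ^^ n) (f i))"
  by (induction n) (auto simp: fps_deriv_sum)

lemma funpow_fps_deriv_add:
  "(fps_deriv ^^ n) (f + g :: complex fps) = (fps_deriv ^^ n) f + (fps_deriv ^^ n) g"
  by (induction n) auto

lemma funpow_fps_deriv_fps_of_poly:
  "(fps_deriv ^^ n) (fps_of_poly p :: complex fps) = fps_of_poly ((pderiv ^^ n) p)"
  by (induction n) (auto simp: fps_of_poly_pderiv)

lemma funpow_pderiv_eq_0:
  "degree p < n \<Longrightarrow> (pderiv ^^ n) (p :: complex poly) = 0"
proof (induction n arbitrary: p)
  case (Suc n)
  show ?case
  proof (cases "degree p = 0")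
    case True
    then have "pderiv p = 0" by (simp add: pderiv_eq_0_iff)
    moreover have "(pderiv ^^ n) (0 :: complex poly) = 0" by (induction n) auto
    ultimately show ?thesis by (simp add: funpow_swap1)
  next
    case False
    then have "degree (pderiv p) < n" using Suc.prems by (simp add: degree_pderiv)
    then show ?thesis using Suc.IH by (simp add: funpow_swap1)
  qed
qed simp

lemma funpow_fps_deriv_nth_eq_0:
  "(\<And>i. i < N \<Longrightarrow> fps_nth (f :: complex fps) i = 0) \<Longrightarrow> i + n < N \<Longrightarrow>
    fps_nth ((fps_deriv ^^ n) f) i = 0"
  by (induction n arbitrary: i) auto

lemma fps_nth_mult_eq_0:
  "(\<And>i. i < N \<Longrightarrow> fps_nth (f :: complex fps) i = 0) \<Longrightarrow> i < N \<Longrightarrow> fps_nth (f * g) i = 0"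
  by (auto simp: fps_mult_nth intro!: sum.neutral)

lemma powr_fps_independent:
  assumes "finite A"
    and "\<And>i j. i \<in> A \<Longrightarrow> j \<in> A \<Longrightarrow> i \<noteq> j \<Longrightarrow> \<omega> i - \<omega> j \<notin> \<int>"
    and "\<And>i. i \<in> A \<Longrightarrow> degree (K i) \<le> \<rho> i"
    and "\<And>n. n < (\<Sum>i\<in>A. \<rho> i + 1) \<Longrightarrow>
      fps_nth (\<Sum>i\<in>A. fps_of_poly (K i) * powr_fps (\<omega> i)) n = 0"
  shows "\<forall>i\<in>A. K i = 0"
  using assms
proof (induction A arbitrary: \<omega> K rule: finite_induct)
  case (insert a A)
  define r where "r = \<rho> a + 1"
  define F where "F = (\<Sum>i\<in>insert a A. fps_of_poly (K i) * powr_fps (\<omega> i))"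
  define \<theta> where "\<theta> i = \<omega> i - \<omega> a" for i
  define N where "N = (\<Sum>i\<in>A. \<rho> i + 1)"
  have N: "(\<Sum>i\<in>insert a A. \<rho> i + 1) = r + N" using insert.hyps by (simp add: r_def N_def)
  have F_0: "fps_nth F n = 0" if "n < r + N" for n
    using insert.prems(3) that unfolding N F_def by blast
  have shift: "F * powr_fps (- \<omega> a) =
      fps_of_poly (K a) + (\<Sum>i\<in>A. fps_of_poly (K i) * powr_fps (\<theta> i))"
  proof -
    have *: "fps_of_poly (K i) * powr_fps (\<omega> i) * powr_fps (- \<omega> a)
        = fps_of_poly (K i) * powr_fps (\<theta> i)" for i
      using powr_fps_add[of "\<omega> i" "- \<omega> a"] by (simp add: \<theta>_def mult.assoc)
    have "\<theta> a = 0" by (simp add: \<theta>_def)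
    then show ?thesis unfolding F_def sum_distrib_right * using insert.hyps by simp
  qed
  have shift_0: "fps_nth (F * powr_fps (- \<omega> a)) n = 0" if "n < r + N" for n
    using F_0 that by (rule fps_nth_mult_eq_0)
  have "\<forall>i\<in>A. \<exists>Q. degree Q \<le> degree (K i) \<and> (Q = 0 \<longrightarrow> K i = 0) \<and>
    (fps_deriv ^^ r) (fps_of_poly (K i) * powr_fps (\<theta> i)) = fps_of_poly Q * powr_fps (\<theta> i - of_nat r)"
  proof
    fix i assume "i \<in> A"
    then have "\<theta> i \<notin> \<int>" unfolding \<theta>_def using insert.hyps insert.prems(1) by auto
    then show "\<exists>Q. degree Q \<le> degree (K i) \<and> (Q = 0 \<longrightarrow> K i = 0) \<and>
        (fps_deriv ^^ r) (fps_of_poly (K i) * powr_fps (\<theta> i)) =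
        fps_of_poly Q * powr_fps (\<theta> i - of_nat r)"
      by (rule deriv_poly_powr_fps_iterated)
  qed
  then obtain Q where Q: "\<And>i. i \<in> A \<Longrightarrow> degree (Q i) \<le> degree (K i)"
    "\<And>i. i \<in> A \<Longrightarrow> Q i = 0 \<Longrightarrow> K i = 0"
    "\<And>i. i \<in> A \<Longrightarrow> (fps_deriv ^^ r) (fps_of_poly (K i) * powr_fps (\<theta> i)) =
      fps_of_poly (Q i) * powr_fps (\<theta> i - of_nat r)"
    by metis
  have "(fps_deriv ^^ r) (fps_of_poly (K a)) = 0"
    using insert.prems(2)[of a]
    by (simp add: funpow_fps_deriv_fps_of_poly funpow_pderiv_eq_0 r_def del: funpow.simps)
  then have deriv: "(fps_deriv ^^ r) (F * powr_fps (- \<omega> a)) =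
      (\<Sum>i\<in>A. fps_of_poly (Q i) * powr_fps (\<theta> i - of_nat r))"
    by (simp add: shift funpow_fps_deriv_add funpow_fps_deriv_sum Q(3))
  have "\<forall>i\<in>A. Q i = 0"
  proof (rule insert.IH[where \<omega> = "\<lambda>i. \<theta> i - of_nat r"])
    show "\<theta> i - of_nat r - (\<theta> j - of_nat r) \<notin> \<int>" if "i \<in> A" "j \<in> A" "i \<noteq> j" for i j
      using insert.prems(1)[of i j] that by (simp add: \<theta>_def)
    show "degree (Q i) \<le> \<rho> i" if "i \<in> A" for i
      using Q(1)[OF that] insert.prems(2)[of i] that by simp
    show "fps_nth (\<Sum>i\<in>A. fps_of_poly (Q i) * powr_fps (\<theta> i - of_nat r)) n = 0"
      if "n < (\<Sum>i\<in>A. \<rho> i + 1)" for n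
      unfolding deriv[symmetric] using shift_0
      by (rule funpow_fps_deriv_nth_eq_0) (use that in \<open>auto simp: N_def\<close>)
  qed
  then have K: "\<forall>i\<in>A. K i = 0" using Q(2) by blast
  then have "F * powr_fps (- \<omega> a) = fps_of_poly (K a)" by (simp add: shift)
  then have "coeff (K a) n = 0" if "n < r" for n using shift_0[of n] that by simp
  moreover have "coeff (K a) n = 0" if "n \<ge> r" for n
    using insert.prems(2)[of a] that by (intro coeff_eq_0) (auto simp: r_def)
  ultimately have "K a = 0" by (intro poly_eqI) (metis coeff_0 not_le)
  then show ?case using K by simp
qed simp

definition pade_fps ::
    "nat \<Rightarrow> (nat \<Rightarrow> complex) \<Rightarrow> (nat \<Rightarrow> complex poly) \<Rightarrow> complex fps" where
  "pade_fps M \<omega> H = (\<Sum>m\<le>M. fps_of_poly (H m) * powr_fps (\<omega> m))"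

lemma has_fps_expansion_pade_fun: "pade_fun M \<omega> H has_fps_expansion pade_fps M \<omega> H"
proof -
  have "poly p has_fps_expansion fps_of_poly p" for p :: "complex poly"
    using eval_fps_has_fps_expansion[of "fps_of_poly p"]
    unfolding eval_fps_of_poly by simp
  then show ?thesis unfolding pade_fun_def pade_fps_def
    by (intro has_fps_expansion_sum has_fps_expansion_mult has_fps_expansion_powr_fps)
qed

lemma pade_order_iff:
  assumes "f has_fps_expansion F" and "c \<noteq> (0 :: complex)"
  shows "zorder f 0 = int n \<and> ((\<lambda>z. f z / z ^ n) \<longlongrightarrow> c) (at 0) \<longleftrightarrow>
    (\<forall>i<n. fps_nth F i = 0) \<and> fps_nth F n = c"
proof -
  have lim: "((\<lambda>z. f z / z ^ n) \<longlongrightarrow> fps_nth F n) (at 0)" if "n \<le> subdegree F"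
  proof -
    have "(\<lambda>z. if z = 0 then fps_nth F n else f z / z ^ n) has_fps_expansion fps_shift n F"
      using assms(1) that by (intro has_fps_expansion_shift) auto
    then have "isCont (\<lambda>z. if z = 0 then fps_nth F n else f z / z ^ n) 0"
      by (rule has_fps_expansion_imp_continuous)
    then have "((\<lambda>z. if z = 0 then fps_nth F n else f z / z ^ n) \<longlongrightarrow> fps_nth F n) (at 0)"
      by (simp add: isCont_def)
    then show ?thesis by (rule Lim_transform_eventually) (auto simp: eventually_at_filter)
  qed
  show ?thesis
  proof (intro iffI conjI)
    assume *: "zorder f 0 = int n \<and> ((\<lambda>z. f z / z ^ n) \<longlongrightarrow> c) (at 0)"
    have "F \<noteq> 0"
    proof
      assume "F = 0"
      then have "((\<lambda>z. f z / z ^ n) \<longlongrightarrow> 0) (at 0)" 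
      proof -
        have "\<forall>\<^sub>F z in nhds 0. f z = 0"
          using assms(1) \<open>F = 0\<close> by (auto simp: has_fps_expansion_def elim!: eventually_mono)
        then have "\<forall>\<^sub>F z in at 0. f z / z ^ n = 0"
          by (auto simp: eventually_at_filter elim!: eventually_mono)
        then show ?thesis by (rule tendsto_eventually)
      qed
      with * have "c = 0" by (intro tendsto_unique[of "at (0::complex)"]) auto
      with assms(2) show False by simp
    qed
    with assms(1) * have n: "subdegree F = n" using has_fps_expansion_zorder_0 by force
    then show "\<forall>i<n. fps_nth F i = 0" by (auto intro: nth_less_subdegree_zero)
    show "fps_nth F n = c"
      using lim n * by (intro tendsto_unique[of "at (0::complex)"]) auto
  next
    assume *: "(\<forall>i<n. fps_nth F i = 0) \<and> fps_nth F n = c"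
    with assms(2) have n: "subdegree F = n" "F \<noteq> 0" by (auto intro!: subdegreeI)
    with assms(1) show "zorder f 0 = int n" using has_fps_expansion_zorder_0 by force
    show "((\<lambda>z. f z / z ^ n) \<longlongrightarrow> c) (at 0)" using lim n * by auto
  qed
qed

lemma is_pade_system_iff:
  "is_pade_system M \<omega> \<rho> H \<longleftrightarrow> (\<forall>m\<le>M. degree (H m) \<le> \<rho> m) \<and>
     (\<forall>i<pade_sigma M \<rho> - 1. fps_nth (pade_fps M \<omega> H) i = 0) \<and>
     fps_nth (pade_fps M \<omega> H) (pade_sigma M \<rho> - 1) = 1 / fact (pade_sigma M \<rho> - 1)"
  unfolding is_pade_system_def by (subst pade_order_iff[OF has_fps_expansion_pade_fun]) auto

lemma pade_sigma_pos: "pade_sigma M \<rho> > 0"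
  by (simp add: pade_sigma_def sum_pos)

lemma ex1_is_pade_system:
  assumes "\<And>i j. \<lbrakk>i \<le> M; j \<le> M; i \<noteq> j\<rbrakk> \<Longrightarrow> \<omega> i - \<omega> j \<notin> \<int>"
  shows "\<exists>!H. is_pade_system M \<omega> \<rho> H \<and> (\<forall>m>M. H m = 0)"
proof -
  define N where "N = pade_sigma M \<rho> - 1"
  have N: "pade_sigma M \<rho> = Suc N" using pade_sigma_pos[of M \<rho>] by (simp add: N_def)
  have indep: "\<forall>m\<le>M. K m = 0"
    if "\<And>m. m \<le> M \<Longrightarrow> degree (K m) \<le> \<rho> m" "\<And>i. i \<le> N \<Longrightarrow> fps_nth (pade_fps M \<omega> K) i = 0"
    for K
    using powr_fps_independent[of "{..M}" \<omega> K \<rho>] that assms N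
    by (auto simp: pade_fps_def pade_sigma_def less_Suc_eq_le)
  have diff: "pade_fps M \<omega> (\<lambda>m. H m - H' m) = pade_fps M \<omega> H - pade_fps M \<omega> H'" for H H'
    by (simp add: pade_fps_def fps_of_poly_diff left_diff_distrib sum_subtractf)

  define I where "I = (SIGMA m:{..M}. {..\<rho> m})"
  have "finite I" "N < card I" using N by (auto simp: I_def pade_sigma_def)
  from homogeneous_system_nontrivial[OF this, of "\<lambda>k (m, j). fps_nth (fps_X ^ j * powr_fps (\<omega> m)) k"]
  obtain x where x: "\<exists>i\<in>I. x i \<noteq> 0"
    "\<And>k. k < N \<Longrightarrow> (\<Sum>i\<in>I. (case i of (m, j) \<Rightarrow> fps_nth (fps_X ^ j * powr_fps (\<omega> m)) k) * x i) = 0"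
    by blast
  define K where "K m = (if m \<le> M then \<Sum>j\<le>\<rho> m. Polynomial.monom (x (m, j)) j else 0)" for m
  have deg_K: "degree (K m) \<le> \<rho> m" for m
    by (auto simp: K_def intro!: degree_sum_le order.trans[OF degree_monom_le])
  have coeff_K: "coeff (K m) j = x (m, j)" if "m \<le> M" "j \<le> \<rho> m" for m j
    using that by (simp add: K_def coeff_sum sum.delta)
  have "pade_fps M \<omega> K = (\<Sum>m\<le>M. \<Sum>j\<le>\<rho> m. fps_const (x (m, j)) * fps_X ^ j * powr_fps (\<omega> m))"
    unfolding pade_fps_def K_def
    by (intro sum.cong) (auto simp: fps_of_poly_sum fps_of_poly_monom sum_distrib_right)
  also have "\<dots> = (\<Sum>(m, j)\<in>I. fps_const (x (m, j)) * (fps_X ^ j * powr_fps (\<omega> m)))"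
    unfolding I_def by (subst sum.Sigma) (auto simp: mult.assoc)
  finally have nth_K: "fps_nth (pade_fps M \<omega> K) k =
      (\<Sum>(m, j)\<in>I. x (m, j) * fps_nth (fps_X ^ j * powr_fps (\<omega> m)) k)" for k
    by (simp add: fps_sum_nth case_prod_unfold)
  have K_0: "fps_nth (pade_fps M \<omega> K) k = 0" if "k < N" for k
    using x(2)[OF that] by (simp only: nth_K case_prod_unfold prod.collapse mult.commute)
  define c where "c = fps_nth (pade_fps M \<omega> K) N"
  have "c \<noteq> 0"
  proof
    assume "c = 0"
    then have "\<forall>m\<le>M. K m = 0"
      by (intro indep deg_K) (metis K_0 c_def le_neq_implies_less)
    then show False using x(1) coeff_K by (force simp: I_def)
  qed
  define H where "H m = Polynomial.smult (1 / (fact N * c)) (K m)" for m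
  have "pade_fps M \<omega> H = fps_const (1 / (fact N * c)) * pade_fps M \<omega> K"
    by (simp add: pade_fps_def H_def fps_of_poly_smult sum_distrib_left mult.assoc)
  then have "is_pade_system M \<omega> \<rho> H"
    unfolding is_pade_system_iff using deg_K K_0 \<open>c \<noteq> 0\<close>
    by (auto simp: N H_def simp flip: c_def)
  moreover have "\<forall>m>M. H m = 0" by (simp add: H_def K_def)
  moreover have "H = H'" if "is_pade_system M \<omega> \<rho> H" "\<forall>m>M. H m = 0"
    "is_pade_system M \<omega> \<rho> H'" "\<forall>m>M. H' m = 0" for H H'
  proof -
    have "\<forall>m\<le>M. H m - H' m = 0"
    proof (rule indep)
      show "degree (H m - H' m) \<le> \<rho> m" if "m \<le> M" for m
        using \<open>is_pade_system M \<omega> \<rho> H\<close> \<open>is_pade_system M \<omega> \<rho> H'\<close> that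
        by (intro degree_diff_le) (auto simp: is_pade_system_def)
      show "fps_nth (pade_fps M \<omega> (\<lambda>m. H m - H' m)) i = 0" if "i \<le> N" for i
        using \<open>is_pade_system M \<omega> \<rho> H\<close> \<open>is_pade_system M \<omega> \<rho> H'\<close> that
        by (cases "i = N") (auto simp: diff is_pade_system_iff N)
    qed
    then show ?thesis using that(2,4) by (intro ext) (metis eq_iff_diff_eq_0 not_le)
  qed
  ultimately show ?thesis by blast
qed

lemma is_pade_system_pade_poly:
  assumes "\<And>i j. \<lbrakk>i \<le> M; j \<le> M; i \<noteq> j\<rbrakk> \<Longrightarrow> \<omega> i - \<omega> j \<notin> \<int>"
  shows "is_pade_system M \<omega> \<rho> (pade_poly M \<omega> \<rho>)"
proof -
  have "\<exists>!H. is_pade_system M \<omega> \<rho> H \<and> (\<forall>m>M. H m = 0)"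
    using assms by (rule ex1_is_pade_system)
  from theI'[OF this] show ?thesis by (simp add: pade_poly_def)
qed

end

theory Submission
  imports Defs
begin

text \<open>The Leibniz formula bounds the degree of the determinant by \<open>\<Sum>\<rho> + S\<close>, which by the
  hypothesis \<open>T + M = S\<close> is the claimed exponent $n$. On the other hand the determinant times
  $(1-z)^{\omega_0}$ is, by Cramer's rule, a polynomial combination of the Pad\'e remainders, whose
  orders at $0$ are all at least $n$.\<close>

text \<open>Each term of the Leibniz formula is a product of entries up to sign. The bound is
  required along every permutation, not row by row, so that a maximum over permutations such as
  \<open>S\<close> can enter.\<close>

lemma degree_det_le_perm:
  fixes A :: "'a :: idom poly mat"
  assumes A: "A \<in> carrier_mat n n"
    and le: "\<And>p. p permutes {0..<n} \<Longrightarrow> (\<Sum>i = 0..<n. degree (A $$ (i, p i))) \<le> d"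
  shows "degree (Determinant.det A) \<le> d"
  unfolding det_def'[OF A]
proof (rule degree_sum_le)
  show "finite {p. p permutes {0..<n}}" by (simp add: finite_permutations)
  fix p assume "p \<in> {p. p permutes {0..<n}}"
  then have p: "p permutes {0..<n}" by simp
  have "degree (signof p * (\<Prod>i = 0..<n. A $$ (i, p i))) \<le> degree (\<Prod>i = 0..<n. A $$ (i, p i))"
    by (simp add: sign_def)
  also have "\<dots> \<le> (\<Sum>i = 0..<n. degree (A $$ (i, p i)))"
    using degree_prod_sum_le[of "{0..<n}" "\<lambda>i. A $$ (i, p i)"] by (simp add: o_def)
  also have "\<dots> \<le> d" by (rule le[OF p])
  finally show "degree (signof p * (\<Prod>i = 0..<n. A $$ (i, p i))) \<le> d" .
qed

text \<open>Row \<open>l\<close> of \<open>adj_mat A * A\<close> is \<open>det A\<close> times the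
  \<open>l\<close>-th unit vector. Applied to the vector of the series
  \<open>powr_fps (\<omega> m)\<close>, it leaves only the one with \<open>m = l\<close>, while
  \<open>A\<close> applied to that vector gives the row series \<open>pade_fps\<close>.\<close>

lemma det_mult_powr_fps:
  assumes A: "A \<in> carrier_mat (M + 1) (M + 1)" and l: "l \<le> M"
  shows "fps_of_poly (Determinant.det A) * powr_fps (\<omega> l) =
    (\<Sum>k\<le>M. fps_of_poly (adj_mat A $$ (l, k)) * pade_fps M \<omega> (\<lambda>m. A $$ (k, m)))"
proof -
  note adj = adj_mat[OF A]
  have entry: "(\<Sum>k\<le>M. adj_mat A $$ (l, k) * A $$ (k, m)) =
      (if m = l then Determinant.det A else 0)" if "m \<le> M" for m
  proof -
    have "(adj_mat A * A) $$ (l, m) = (\<Sum>k\<le>M. adj_mat A $$ (l, k) * A $$ (k, m))"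
      using A adj(1) l that
      by (simp add: times_mat_def scalar_prod_def atLeast0AtMost atLeastLessThanSuc_atLeastAtMost)
    then show ?thesis using l that by (auto simp: adj(3))
  qed
  \<comment> \<open>Swapping the sums collects the coefficient of each power, to which
    \<open>entry\<close> applies.\<close>
  have "(\<Sum>k\<le>M. fps_of_poly (adj_mat A $$ (l, k)) * pade_fps M \<omega> (\<lambda>m. A $$ (k, m))) =
      (\<Sum>m\<le>M. \<Sum>k\<le>M. fps_of_poly (adj_mat A $$ (l, k) * A $$ (k, m)) * powr_fps (\<omega> m))"
    unfolding pade_fps_def sum_distrib_left
    by (subst sum.swap) (simp add: fps_of_poly_mult mult.assoc)
  also have "\<dots> = (\<Sum>m\<le>M. if m = l then fps_of_poly (Determinant.det A) * powr_fps (\<omega> m) else 0)"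
  proof (rule sum.cong[OF refl])
    fix m assume "m \<in> {..M}"
    then show "(\<Sum>k\<le>M. fps_of_poly (adj_mat A $$ (l, k) * A $$ (k, m)) * powr_fps (\<omega> m)) =
        (if m = l then fps_of_poly (Determinant.det A) * powr_fps (\<omega> m) else 0)"
      unfolding sum_distrib_right[symmetric] fps_of_poly_sum[symmetric] by (simp add: entry)
  qed
  also have "\<dots> = fps_of_poly (Determinant.det A) * powr_fps (\<omega> l)" using l by simp
  finally show ?thesis ..
qed

text \<open>A polynomial combination of series vanishing to order \<open>n\<close> does so too, and
  \<open>powr_fps (\<omega> 0)\<close> is a unit, so removing it from the left side of
  \<open>det_mult_powr_fps\<close> keeps the order.\<close>

lemma coeff_det_eq_0:
  assumes A: "A \<in> carrier_mat (M + 1) (M + 1)"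
    and zero: "\<And>k i. k \<le> M \<Longrightarrow> i < n \<Longrightarrow> fps_nth (pade_fps M \<omega> (\<lambda>m. A $$ (k, m))) i = 0"
    and i: "i < n"
  shows "coeff (Determinant.det A) i = 0"
proof -
  have "fps_nth (fps_of_poly (Determinant.det A) * powr_fps (\<omega> 0)) j = 0" if "j < n" for j
  proof -
    have "fps_nth (pade_fps M \<omega> (\<lambda>m. A $$ (k, m)) * fps_of_poly (adj_mat A $$ (0, k))) j = 0"
      if "k \<le> M" for k
      using zero[OF that] \<open>j < n\<close> by (rule fps_nth_mult_eq_0)
    then show ?thesis unfolding det_mult_powr_fps[OF A le0] fps_sum_nth
      by (intro sum.neutral) (simp add: mult.commute)
  qed
  from fps_nth_mult_eq_0[OF this i]
  have "fps_nth (fps_of_poly (Determinant.det A) * powr_fps (\<omega> 0) * powr_fps (- \<omega> 0)) i = 0" .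
  moreover have "powr_fps (\<omega> 0) * powr_fps (- \<omega> 0) = 1"
    using powr_fps_add[of "\<omega> 0" "- \<omega> 0"] by simp
  ultimately show ?thesis by (simp add: mult.assoc)
qed

theorem theorem6:
  fixes M :: nat
    and \<omega> :: "nat \<Rightarrow> complex"
    and \<rho> :: "nat \<Rightarrow> nat"
    and \<epsilon> :: "nat \<Rightarrow> nat \<Rightarrow> int"
    and S T :: int
  assumes "\<And>i j. \<lbrakk>i \<le> M; j \<le> M; i \<noteq> j\<rbrakk> \<Longrightarrow> \<omega> i \<noteq> \<omega> j"
    and "\<And>i j. \<lbrakk>i \<le> M; j \<le> M; i \<noteq> j\<rbrakk> \<Longrightarrow> \<omega> i - \<omega> j \<notin> \<int>"
    and "\<And>k j. \<lbrakk>k \<le> M; j \<le> M\<rbrakk> \<Longrightarrow> int (\<rho> j) + \<epsilon> k j \<ge> 0"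
    and "S = Max ((\<lambda>\<beta>. \<Sum>i\<le>M. \<epsilon> i (\<beta> i)) ` {\<beta>. \<beta> permutes {..M}})"
    and "T = Min ((\<lambda>i. \<Sum>j\<le>M. \<epsilon> i j) ` {..M})"
    and "\<exists>!\<alpha>. \<alpha> permutes {..M} \<and> S = (\<Sum>i\<le>M. \<epsilon> i (\<alpha> i))"
    and "T + int M = S"
  shows "\<exists>C n. int n = int (pade_sigma M \<rho>) + T - 1 \<and>
    Determinant.det (Matrix.mat (M + 1) (M + 1)
      (\<lambda>(k, m). pade_poly M \<omega> (\<lambda>j. nat (int (\<rho> j) + \<epsilon> k j)) m)) = Polynomial.monom C n"
proof -
  define r where "r k j = nat (int (\<rho> j) + \<epsilon> k j)" for k j
  define n where "n = nat (int (pade_sigma M \<rho>) + T - 1)"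
  define A where "A = Matrix.mat (M + 1) (M + 1) (\<lambda>(k, m). pade_poly M \<omega> (r k) m)"
  have r: "int (r k j) = int (\<rho> j) + \<epsilon> k j" if "k \<le> M" "j \<le> M" for k j
    using assms(3)[OF that] by (simp add: r_def)
  have A: "A \<in> carrier_mat (M + 1) (M + 1)" by (simp add: A_def)
  have A_entry: "A $$ (k, m) = pade_poly M \<omega> (r k) m" if "k \<le> M" "m \<le> M" for k m
    using that by (simp add: A_def)
  have pade: "is_pade_system M \<omega> (r k) (pade_poly M \<omega> (r k))" for k
    using assms(2) by (rule is_pade_system_pade_poly)

  have sigma: "int (pade_sigma M (r k)) = int (pade_sigma M \<rho>) + (\<Sum>j\<le>M. \<epsilon> k j)" if "k \<le> M" for k
    using r[OF that] by (simp add: pade_sigma_def sum.distrib)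
  have T_le: "T \<le> (\<Sum>j\<le>M. \<epsilon> k j)" if "k \<le> M" for k
    unfolding assms(5) using that by (intro Min_le) auto
  \<comment> \<open>The minimum is attained at some row \<open>k0\<close>, so \<sigma>(\<rho>) + T
    is the \<sigma> of an actual degree vector and hence positive. Thus \<open>nat\<close> in the
    definition of \<open>n\<close> truncates nothing.\<close>
  have "T \<in> (\<lambda>i. \<Sum>j\<le>M. \<epsilon> i j) ` {..M}"
    unfolding assms(5) by (intro Min_in) auto
  then obtain k0 where "k0 \<le> M" "T = (\<Sum>j\<le>M. \<epsilon> k0 j)" by auto
  then have "int (pade_sigma M \<rho>) + T \<ge> 1"
    using sigma[of k0] pade_sigma_pos[of M "r k0"] by linarith
  then have n: "int n = int (pade_sigma M \<rho>) + T - 1" by (simp add: n_def)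

  have "coeff (Determinant.det A) i = 0" if "i < n" for i
  proof (rule coeff_det_eq_0[OF A _ that, where \<omega> = \<omega>])
    fix k i assume "k \<le> M" "i < n"
    have "pade_fps M \<omega> (\<lambda>m. A $$ (k, m)) = pade_fps M \<omega> (pade_poly M \<omega> (r k))"
      using \<open>k \<le> M\<close> by (simp add: pade_fps_def A_entry)
    \<comment> \<open>The remainder of row \<open>k\<close> has order \<sigma>(\<rho>) - 1 plus the
      \<open>k\<close>-th row sum of \<epsilon>. That row sum is at least \<open>T\<close>, so the
      order is at least \<open>n\<close>.\<close>
    moreover have "i < pade_sigma M (r k) - 1"
      using n \<open>i < n\<close> sigma[OF \<open>k \<le> M\<close>] T_le[OF \<open>k \<le> M\<close>] by linarith
    ultimately show "fps_nth (pade_fps M \<omega> (\<lambda>m. A $$ (k, m))) i = 0"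
      using pade[of k] by (simp add: is_pade_system_iff)
  qed
  moreover have "degree (Determinant.det A) \<le> n"
  proof (rule degree_det_le_perm[OF A])
    fix p assume "p permutes {0..<M + 1}"
    moreover have atMost: "{0..<M + 1} = {..M}" by auto
    ultimately have p: "p permutes {..M}" by simp
    then have p_le: "p k \<le> M" if "k \<le> M" for k
      using permutes_in_image[of p "{..M}" k] that by simp
    have "int (\<Sum>k\<le>M. degree (A $$ (k, p k))) \<le> int (\<Sum>k\<le>M. r k (p k))"
      unfolding of_nat_le_iff using pade p_le by (intro sum_mono) (auto simp: A_entry is_pade_system_def)
    also have "\<dots> = (\<Sum>k\<le>M. int (\<rho> (p k))) + (\<Sum>k\<le>M. \<epsilon> k (p k))"
      using r p_le by (simp add: sum.distrib)
    also have "(\<Sum>k\<le>M. int (\<rho> (p k))) = (\<Sum>k\<le>M. int (\<rho> k))"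
      using sum.permute[OF p, of "\<lambda>k. int (\<rho> k)"] by (simp add: o_def)
    also have "(\<Sum>k\<le>M. \<epsilon> k (p k)) \<le> S"
      unfolding assms(4) using p by (intro Max_ge) (auto simp: finite_permutations)
    \<comment> \<open>Since \<sigma>(\<rho>) is the sum of the \<rho> k plus M + 1, the hypothesis T
      + M = S makes the degree bound equal to the order bound.\<close>
    also have "(\<Sum>k\<le>M. int (\<rho> k)) + S = int n"
      using n assms(7) by (simp add: pade_sigma_def sum.distrib)
    finally show "(\<Sum>k = 0..<M + 1. degree (A $$ (k, p k))) \<le> n"
      unfolding atMost of_nat_le_iff by simp
  qed
  \<comment> \<open>Coefficients below \<open>n\<close> vanish by the order, those above
    \<open>n\<close> by the degree.\<close>
  ultimately have "Determinant.det A = Polynomial.monom (coeff (Determinant.det A) n) n"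
    by (auto intro!: poly_eqI coeff_eq_0 simp: neq_iff)
  then show ?thesis using n unfolding A_def r_def by blast
qed

end
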